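(* Let $n\ge 1$, $k>1$ and $r>0$ be integers. The number of permutations of size $n$ avoiding arithmetic progressions of length $k$ and difference $r$ is $|\operatorname{Av}_n(\underline{\operatorname{dist}_{r}(12\cdots k)})|$, which can be obtained from the following formula, where $l=\lfloor \frac{n}{r+1}\rfloor$ and $u = n \bmod (r+1)\in[0,r]$: $$|\operatorname{Av}_n(\underline{\operatorname{dist}_{r}(12\cdots k)})|=\frac{n!}{(l!)^{r+1-u}((l+1)!)^{u}}\,|\operatorname{Av}_{l}(\underline{12\cdots k})|^{r+1-u}\,|\operatorname{Av}_{l+1}(\underline{12\cdots k})|^{u}.$$
   Context: Permutations $\pi=\pi_1\cdots\pi_n$ of $[n]=\{1,\dots,n\}$ are in one-line notation. A permutation $\pi$ contains an arithmetic progression of length $k$ and difference $r$ if there are positions $i_1<i_2<\cdots<i_k$ and a number $x$ with $\pi_{i_m}=x+(m-1)r$ for $m=1,\dots,k$; otherwise it avoids such progressions. The consecutive distant pattern $\underline{\operatorname{dist}_{r}(12\cdots k)}=\underline{1\square^{r}2\square^{r}\cdots\square^{r}k}$ is the pattern $12\cdots k$ with a gap of exactly $r$ letters required between each two consecutive letters of the pattern; thus $\operatorname{Av}_n(\underline{\operatorname{dist}_{r}(12\cdots k)})$ is the set of permutations of $[n]$ with no position $y\ge 1$ such that $y+(k-1)(r+1)\le n$ and $\pi_y<\pi_{y+(r+1)}<\cdots<\pi_{y+(k-1)(r+1)}$. $\operatorname{Av}_m(\underline{12\cdots k})$ is the set of permutations of $[m]$ with no $k$ entries in adjacent positions that are increasing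 from left to right (with $|\operatorname{Av}_0(\underline{12\cdots k})|=1$).
   Formalization: The arithmetic progressions avoided have difference r+1 rather than r, since a gap of exactly r letters means a position step of r+1; with difference r the first equality fails, e.g. for n=2, k=2, r=1 (1 versus 2). *)

theory Defs
  imports Complex_Main "HOL-Combinatorics.Permutations"
begin

text \<open>
  A permutation of \<open>[n]\<close> is a function \<open>p\<close> with \<open>p permutes {1..n}\<close>; its one-line notation is
  \<open>p 1, \<dots>, p n\<close>, so positions and values both start at 1.
\<close>

definition contains_arith_prog :: "nat \<Rightarrow> nat \<Rightarrow> nat \<Rightarrow> (nat \<Rightarrow> nat) \<Rightarrow> bool" where
  "contains_arith_prog n k d p \<longleftrightarrow>
     (\<exists>i x. strict_mono_on {1..k} i \<and> i ` {1..k} \<subseteq> {1..n} \<and>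
            (\<forall>m\<in>{1..k}. p (i m) = x + (m - 1) * d))"

definition Av_arith_prog :: "nat \<Rightarrow> nat \<Rightarrow> nat \<Rightarrow> (nat \<Rightarrow> nat) set" where
  "Av_arith_prog n k d = {p. p permutes {1..n} \<and> \<not> contains_arith_prog n k d p}"

text \<open>
  The consecutive distant pattern \<open>1 \<box>\<^sup>r 2 \<box>\<^sup>r \<dots> \<box>\<^sup>r k\<close>. A gap of exactly \<open>r\<close> letters puts two
  consecutive letters of the pattern at positions that differ by \<open>r + 1\<close>, not by \<open>r\<close>.
\<close>

definition contains_dist_incr :: "nat \<Rightarrow> nat \<Rightarrow> nat \<Rightarrow> (nat \<Rightarrow> nat) \<Rightarrow> bool" where
  "contains_dist_incr n r k p \<longleftrightarrow>
     (\<exists>y\<ge>1. y + (k - 1) * (r + 1) \<le> n \<and>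
            (\<forall>j<k - 1. p (y + j * (r + 1)) < p (y + (j + 1) * (r + 1))))"

definition Av_dist_incr :: "nat \<Rightarrow> nat \<Rightarrow> nat \<Rightarrow> (nat \<Rightarrow> nat) set" where
  "Av_dist_incr n r k = {p. p permutes {1..n} \<and> \<not> contains_dist_incr n r k p}"

definition contains_consec_incr :: "nat \<Rightarrow> nat \<Rightarrow> (nat \<Rightarrow> nat) \<Rightarrow> bool" where
  "contains_consec_incr m k p \<longleftrightarrow>
     (\<exists>y\<ge>1. y + (k - 1) \<le> m \<and> (\<forall>j<k - 1. p (y + j) < p (y + j + 1)))"

definition Av_consec_incr :: "nat \<Rightarrow> nat \<Rightarrow> (nat \<Rightarrow> nat) set" where
  "Av_consec_incr m k = {p. p permutes {1..m} \<and> \<not> contains_consec_incr m k p}"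

end

(*
  Taking inverses turns a progression of values at increasing positions into increasing entries
  at positions in arithmetic progression, which gives the first equality.

  For the formula, the distant pattern only compares entries whose positions are congruent modulo
  r + 1, and on each residue class it is the consecutive pattern.  The constraints on different
  classes are independent: rearranging the entries inside one class C does not affect the other
  classes, and among the |C|! rearrangements exactly |Av_|C|(12...k)| satisfy the constraint on C.
  Double counting the pairs (permutation, rearrangement) then multiplies the count by
  |Av_|C|(12...k)| / |C|! for each class.
*)
theory Submission imports Defs begin

section \<open>Independent constraints on disjoint blocks of positions\<close>

text \<open>\<open>local\<close> says that \<open>P c\<close> reads \<open>p\<close> only on the
  block \<open>C c\<close>. The assumption \<open>N\<close> says that the number of rearrangements
  inside the block that achieve \<open>P c\<close> is the same for every \<open>p\<close>. The
  induction adds one block at a time. The conclusion is multiplied out so that it stays in the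
  naturals.\<close>

lemma card_permutes_blockwise:
  fixes C :: "'b \<Rightarrow> 'a set"
  assumes "finite S" "finite J"
    and sub: "\<And>c. c \<in> J \<Longrightarrow> C c \<subseteq> S"
    and disj: "\<And>c c'. c \<in> J \<Longrightarrow> c' \<in> J \<Longrightarrow> c \<noteq> c' \<Longrightarrow> C c \<inter> C c' = {}"
    and local: "\<And>c p q. c \<in> J \<Longrightarrow> (\<And>x. x \<in> C c \<Longrightarrow> p x = q x) \<Longrightarrow> P c p \<longleftrightarrow> P c q"
    and N: "\<And>c p. c \<in> J \<Longrightarrow> p permutes S \<Longrightarrow> card {s. s permutes C c \<and> P c (p \<circ> s)} = N c"
  shows "card {p. p permutes S \<and> (\<forall>c\<in>J. P c p)} * (\<Prod>c\<in>J. fact (card (C c)))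
           = fact (card S) * (\<Prod>c\<in>J. N c)"
  using assms(2) sub disj local N
proof (induction J rule: finite_induct)
  case empty
  then show ?case using card_permutations[OF refl assms(1)] by simp
next
  case (insert b J)
  define M where "M = {p. p permutes S \<and> (\<forall>c\<in>J. P c p)}"
  define R where "R = {s. s permutes C b}"
  have fin_C: "finite (C b)" using finite_subset[OF insert.prems(1) assms(1)] by blast
  have fin: "finite M" "finite R"
    unfolding M_def R_def using finite_permutations[OF assms(1)] finite_permutations[OF fin_C]
    by simp_all
  have IH: "card M * (\<Prod>c\<in>J. fact (card (C c))) = fact (card S) * (\<Prod>c\<in>J. N c)"
    unfolding M_def
  proof (rule insert.IH)
    show "P c p \<longleftrightarrow> P c q" if "c \<in> J" "\<And>x. x \<in> C c \<Longrightarrow> p x = q x" for c p q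
      using insert.prems(3)[of c p q] that by blast
    show "C c \<inter> C c' = {}" if "c \<in> J" "c' \<in> J" "c \<noteq> c'" for c c'
      using insert.prems(2)[of c c'] that by blast
    show "C c \<subseteq> S" if "c \<in> J" for c
      using insert.prems(1)[of c] that by blast
    show "card {s. s permutes C c \<and> P c (p \<circ> s)} = N c" if "c \<in> J" "p permutes S" for c p
      using insert.prems(4)[of c p] that by blast
  qed
  \<comment> \<open>Composing with \<open>s\<close> on the right only moves entries inside the new
    block \<open>C b\<close>, which is disjoint from the old blocks, so the constraints already
    imposed survive.\<close>
  have M_comp: "p \<circ> s \<in> M" if "p \<in> M" "s \<in> R" for p s
  proof -
    have s: "s permutes C b" using that(2) by (simp add: R_def)
    have "P c (p \<circ> s)" if c: "c \<in> J" for c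
    proof -
      have "C b \<inter> C c = {}" using insert.hyps(2) insert.prems(2)[of b c] c by auto
      then have "x \<notin> C b" if "x \<in> C c" for x using that by blast
      then have "(p \<circ> s) x = p x" if "x \<in> C c" for x
        using that permutes_not_in[OF s] by simp
      then have "P c (p \<circ> s) \<longleftrightarrow> P c p" using c insert.prems(3)[of c "p \<circ> s" p] by blast
      then show ?thesis using \<open>p \<in> M\<close> c by (simp add: M_def)
    qed
    moreover have "p \<circ> s permutes S"
      using that(1) permutes_subset[OF s insert.prems(1)]
      by (auto simp: M_def intro: permutes_compose)
    ultimately show ?thesis by (simp add: M_def)
  qed
  have shift: "card {p \<in> M. P b (p \<circ> s)} = card {p \<in> M. P b p}" if s: "s \<in> R" for s
  proof (rule bij_betw_same_card[of "\<lambda>p. p \<circ> s"])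
    have sp: "s permutes C b" and "inv s \<in> R"
      using s by (simp_all add: R_def permutes_inv)
    then show "bij_betw (\<lambda>p. p \<circ> s) {p \<in> M. P b (p \<circ> s)} {p \<in> M. P b p}"
      using M_comp s
      by (intro bij_betw_byWitness[where f' = "\<lambda>p. p \<circ> inv s"])
         (auto simp: comp_assoc permutes_inv_o[OF sp])
  qed
  \<comment> \<open>Count the pairs \<open>(p, s)\<close> in \<open>M\<close> times \<open>R\<close>
    with \<open>P b (p \<circ> s)\<close>. For fixed \<open>s\<close> the count is always
    \<open>card {p \<in> M. P b p}\<close> by \<open>shift\<close>; for fixed \<open>p\<close> it is
    \<open>N b\<close>.\<close>
  have "card {p \<in> M. P b p} * card R = (\<Sum>s\<in>R. card {p \<in> M. P b (p \<circ> s)})"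
    using shift by simp
  also have "\<dots> = (\<Sum>p\<in>M. card {s \<in> R. P b (p \<circ> s)})"
    using fin(2,1) by (rule sum_multicount_gen) simp
  also have "\<dots> = card M * N b"
  proof -
    have "card {s \<in> R. P b (p \<circ> s)} = N b" if "p \<in> M" for p
      using insert.prems(4)[of b p] that by (simp only: M_def R_def mem_Collect_eq insertI1)
    then show ?thesis by simp
  qed
  finally have step: "card {p \<in> M. P b p} * fact (card (C b)) = card M * N b"
    using card_permutations[OF refl fin_C]
    by (simp add: R_def)
  have set_eq: "{p. p permutes S \<and> (\<forall>c\<in>insert b J. P c p)} = {p \<in> M. P b p}"
    by (auto simp: M_def)
  have "card {p \<in> M. P b p} * (\<Prod>c\<in>insert b J. fact (card (C c)))
      = (card {p \<in> M. P b p} * fact (card (C b))) * (\<Prod>c\<in>J. fact (card (C c)))"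
    by (simp only: prod.insert[OF insert.hyps] mult.assoc)
  also have "\<dots> = N b * (card M * (\<Prod>c\<in>J. fact (card (C c))))"
    unfolding step by (simp only: ac_simps)
  also have "\<dots> = fact (card S) * (\<Prod>c\<in>insert b J. N c)"
    unfolding IH by (simp only: prod.insert[OF insert.hyps] ac_simps)
  finally show ?case unfolding set_eq .
qed

section \<open>Rearrangements of one block that avoid the consecutive pattern\<close>

lemma ex_permutes_order_equiv:
  fixes g :: "nat \<Rightarrow> 'a :: linorder"
  assumes "inj_on g {1..m}"
  shows "\<exists>h. h permutes {1..m} \<and> (\<forall>i\<in>{1..m}. \<forall>j\<in>{1..m}. h i < h j \<longleftrightarrow> g i < g j)"
proof -
  \<comment> \<open>Standardization: \<open>h j\<close> is the rank of \<open>g j\<close>. Counting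
    with \<le> includes \<open>j\<close> itself, so ranks start at 1. Outside the interval
    \<open>h\<close> is the identity, as \<open>permutes\<close> demands.\<close>
  define h where "h j = (if j \<in> {1..m} then card {i \<in> {1..m}. g i \<le> g j} else j)" for j
  have less: "h i < h j" if "i \<in> {1..m}" "j \<in> {1..m}" "g i < g j" for i j
  proof -
    have "{x \<in> {1..m}. g x \<le> g i} \<subset> {x \<in> {1..m}. g x \<le> g j}"
    proof (rule psubsetI)
      show "{x \<in> {1..m}. g x \<le> g i} \<subseteq> {x \<in> {1..m}. g x \<le> g j}" using that by auto
      have "j \<in> {x \<in> {1..m}. g x \<le> g j} - {x \<in> {1..m}. g x \<le> g i}" using that by auto
      then show "{x \<in> {1..m}. g x \<le> g i} \<noteq> {x \<in> {1..m}. g x \<le> g j}" by blast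
    qed
    then have "card {x \<in> {1..m}. g x \<le> g i} < card {x \<in> {1..m}. g x \<le> g j}"
      by (intro psubset_card_mono) simp_all
    then show ?thesis using that(1,2) by (simp only: h_def if_True)
  qed
  have iff: "h i < h j \<longleftrightarrow> g i < g j" if "i \<in> {1..m}" "j \<in> {1..m}" for i j
    using less[OF that] less[OF that(2,1)] inj_onD[OF assms _ that]
    by (cases "g i" "g j" rule: linorder_cases) auto
  have "inj_on h {1..m}"
  proof (rule inj_onI)
    fix i j assume ij: "i \<in> {1..m}" "j \<in> {1..m}" "h i = h j"
    then have "g i = g j"
      using less[OF ij(1,2)] less[OF ij(2,1)] by (cases "g i" "g j" rule: linorder_cases) auto
    then show "i = j" using inj_onD[OF assms] ij(1,2) by blast
  qed
  moreover have "h ` {1..m} \<subseteq> {1..m}"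
  proof (rule image_subsetI)
    fix j assume j: "j \<in> {1..m}"
    have "card {i \<in> {1..m}. g i \<le> g j} \<le> card {1..m}" by (rule card_mono) auto
    moreover have "card {i \<in> {1..m}. g i \<le> g j} > 0" using j by (auto simp: card_gt_0_iff)
    ultimately show "h j \<in> {1..m}" using j by (simp add: h_def)
  qed
  ultimately have "bij_betw h {1..m} {1..m}"
    by (simp add: bij_betw_def endo_inj_surj)
  then have "h permutes {1..m}" by (rule bij_imp_permutes) (simp only: h_def if_False)
  then show ?thesis using iff by blast
qed

lemma contains_consec_incr_cong:
  assumes "\<And>i j. i \<in> {1..m} \<Longrightarrow> j \<in> {1..m} \<Longrightarrow> p i < p j \<longleftrightarrow> q i < q j"
  shows "contains_consec_incr m k p \<longleftrightarrow> contains_consec_incr m k q"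
  unfolding contains_consec_incr_def
  by (intro ex_cong1 conj_cong refl all_cong assms) auto

text \<open>The pattern sees only the relative order of entries, so \<open>g\<close> can be replaced
  by its standardization \<open>h\<close>. Composing with the permutation \<open>h\<close> on the
  left then maps the good rearrangements bijectively onto the avoiders.\<close>

lemma card_avoiding_rearrangements:
  assumes "inj_on g {1..m}"
  shows "card {t. t permutes {1..m} \<and> \<not> contains_consec_incr m k (g \<circ> t)}
           = card (Av_consec_incr m k)"
proof -
  obtain h where h: "h permutes {1..m}"
    and order: "\<forall>i\<in>{1..m}. \<forall>j\<in>{1..m}. h i < h j \<longleftrightarrow> g i < g j"
    using ex_permutes_order_equiv[OF assms] by blast
  have eq: "contains_consec_incr m k (g \<circ> t) \<longleftrightarrow> contains_consec_incr m k (h \<circ> t)"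
    if "t permutes {1..m}" for t
    using order permutes_in_image[OF that] by (intro contains_consec_incr_cong) simp
  have "bij_betw (\<lambda>t. h \<circ> t) {t. t permutes {1..m} \<and> \<not> contains_consec_incr m k (h \<circ> t)}
      (Av_consec_incr m k)"
    unfolding Av_consec_incr_def
    using permutes_compose[OF _ h] permutes_compose[OF _ permutes_inv[OF h]]
    by (intro bij_betw_byWitness[where f' = "\<lambda>t. inv h \<circ> t"])
       (auto simp: comp_assoc[symmetric] permutes_inv_o[OF h])
  then show ?thesis using eq by (simp add: bij_betw_same_card cong: conj_cong)
qed

text \<open>The same count for a block of arbitrary positions, listed by \<open>e\<close>. It
  supplies the assumption \<open>N\<close> of \<open>card_permutes_blockwise\<close>.\<close>

lemma card_avoiding_rearrangements_image:
  assumes e: "inj_on e {1..m}" and p: "inj p"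
  shows "card {s. s permutes e ` {1..m} \<and> \<not> contains_consec_incr m k (p \<circ> s \<circ> e)}
           = card (Av_consec_incr m k)"
proof -
  \<comment> \<open>\<open>F t\<close> is \<open>t\<close> conjugated by \<open>e\<close> and
    extended by the identity, so \<open>F t \<circ> e\<close> agrees with \<open>e \<circ> t\<close>
    on \<open>{1..m}\<close>.\<close>
  define F where "F = (\<lambda>t x. if x \<in> e ` {1..m} then e (t (inv_into {1..m} e x)) else x)"
  have F: "bij_betw F {t. t permutes {1..m}} {s. s permutes e ` {1..m}}"
    unfolding F_def by (rule bij_betw_permutations) (rule inj_on_imp_bij_betw[OF e])
  have eq: "contains_consec_incr m k (p \<circ> F t \<circ> e) \<longleftrightarrow> contains_consec_incr m k (p \<circ> e \<circ> t)" for t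
  proof (rule contains_consec_incr_cong)
    have "(p \<circ> F t \<circ> e) i = (p \<circ> e \<circ> t) i" if "i \<in> {1..m}" for i
      using that inv_into_f_f[OF e that] by (simp only: comp_apply F_def imageI if_True)
    then show "(p \<circ> F t \<circ> e) i < (p \<circ> F t \<circ> e) j \<longleftrightarrow> (p \<circ> e \<circ> t) i < (p \<circ> e \<circ> t) j"
      if "i \<in> {1..m}" "j \<in> {1..m}" for i j
      using that by presburger
  qed
  have "inj_on (p \<circ> e) {1..m}" using e p by (simp add: comp_inj_on inj_on_subset)
  note card_avoiding_rearrangements[OF this, of k, symmetric]
  also have "card {t. t permutes {1..m} \<and> \<not> contains_consec_incr m k (p \<circ> e \<circ> t)}
      = card {s. s permutes e ` {1..m} \<and> \<not> contains_consec_incr m k (p \<circ> s \<circ> e)}"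
  proof (rule bij_betw_same_card[OF bij_betw_subset[OF F]])
    show "F ` {t. t permutes {1..m} \<and> \<not> contains_consec_incr m k (p \<circ> e \<circ> t)}
      = {s. s permutes e ` {1..m} \<and> \<not> contains_consec_incr m k (p \<circ> s \<circ> e)}"
      using bij_betw_imp_surj_on[OF F] by (fastforce simp: eq)
  qed auto
  finally show ?thesis by simp
qed

section \<open>Passing to the inverse permutation\<close>

lemma contains_arith_prog_iff_inv:
  assumes p: "p permutes {1..n}" and k: "k > 1"
  shows "contains_arith_prog n k (r + 1) p \<longleftrightarrow> contains_dist_incr n r k (inv p)"
proof
  assume "contains_arith_prog n k (r + 1) p"
  then obtain i x where mono: "strict_mono_on {1..k} i" and range: "i ` {1..k} \<subseteq> {1..n}"
    and val: "\<forall>m\<in>{1..k}. p (i m) = x + (m - 1) * (r + 1)"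
    unfolding contains_arith_prog_def by blast
  have pin: "p (i m) \<in> {1..n}" if "m \<in> {1..k}" for m
    using that range permutes_in_image[OF p] by blast
  have inv: "inv p (x + (m - 1) * (r + 1)) = i m" if "m \<in> {1..k}" for m
    using val that permutes_inverses(2)[OF p] by metis
  \<comment> \<open>The first term of the progression gives the lower bound and the last term the
    upper bound, since both are values of \<open>p\<close> at positions in
    \<open>{1..n}\<close>.\<close>
  have "x \<ge> 1" "x + (k - 1) * (r + 1) \<le> n"
    using pin[of 1] pin[of k] val k by auto
  moreover have "inv p (x + j * (r + 1)) < inv p (x + (j + 1) * (r + 1))" if "j < k - 1" for j
    using that inv[of "j + 1"] inv[of "j + 2"] strict_mono_onD[OF mono, of "j + 1" "j + 2"] by auto
  ultimately show "contains_dist_incr n r k (inv p)"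
    unfolding contains_dist_incr_def by blast
next
  assume "contains_dist_incr n r k (inv p)"
  then obtain y where y: "y \<ge> 1" "y + (k - 1) * (r + 1) \<le> n"
    and incr: "\<And>j. j < k - 1 \<Longrightarrow> inv p (y + j * (r + 1)) < inv p (y + (j + 1) * (r + 1))"
    unfolding contains_dist_incr_def by blast
  \<comment> \<open>The positions are forced: \<open>i m\<close> is where \<open>p\<close> takes the
    \<open>m\<close>-th term of the progression.\<close>
  define i where "i m = inv p (y + (m - 1) * (r + 1))" for m
  have step: "i (Suc m) > i m" if "1 \<le> m" "m < k" for m
    using incr[of "m - 1"] that by (simp add: i_def)
  have "strict_mono_on {1..k} i"
  proof (rule strict_mono_onI)
    fix a b assume "a \<in> {1..k}" "b \<in> {1..k}" "a < b"
    from \<open>a < b\<close> \<open>b \<in> {1..k}\<close> \<open>a \<in> {1..k}\<close> show "i a < i b"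
    proof (induction a b rule: less_Suc_induct)
      case (1 a)
      then show ?case using step by simp
    next
      case (2 a b c)
      then show ?case by fastforce
    qed
  qed
  moreover have "i ` {1..k} \<subseteq> {1..n}"
  proof (rule image_subsetI)
    fix m assume "m \<in> {1..k}"
    then have "(m - 1) * (r + 1) \<le> (k - 1) * (r + 1)" by (intro mult_right_mono) auto
    then have "y + (m - 1) * (r + 1) \<in> {1..n}" using y by simp
    then show "i m \<in> {1..n}"
      unfolding i_def using permutes_in_image[OF permutes_inv[OF p]] by blast
  qed
  moreover have "\<forall>m\<in>{1..k}. p (i m) = y + (m - 1) * (r + 1)"
    by (simp add: i_def permutes_inverses(1)[OF p])
  ultimately show "contains_arith_prog n k (r + 1) p"
    unfolding contains_arith_prog_def by blast
qed

lemma card_Av_arith_prog: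
  assumes "k > 1"
  shows "card (Av_arith_prog n k (r + 1)) = card (Av_dist_incr n r k)"
proof -
  have eq: "Av_arith_prog n k (r + 1) = {p. p permutes {1..n} \<and> \<not> contains_dist_incr n r k (inv p)}"
    unfolding Av_arith_prog_def using contains_arith_prog_iff_inv[OF _ assms] by blast
  have "bij_betw inv (Av_arith_prog n k (r + 1)) (Av_dist_incr n r k)"
    unfolding eq Av_dist_incr_def
    by (intro bij_betw_byWitness[where f' = inv]) (auto simp: permutes_inv permutes_inv_inv)
  then show ?thesis by (rule bij_betw_same_card)
qed

section \<open>Splitting the positions into residue classes modulo r + 1\<close>

text \<open>\<open>e r c\<close> lists the positions congruent to \<open>c\<close>, and
  \<open>m n r c\<close> counts those up to \<open>n\<close>. Adding \<open>r + 1\<close> before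
  subtracting \<open>c\<close> avoids truncation and gives 0 when \<open>c > n\<close>. A step of 1
  in the index is a step of \<open>r + 1\<close> in the position, so the distant pattern becomes the
  consecutive one.\<close>

lemma contains_dist_incr_iff_residue_class:
  defines "e \<equiv> \<lambda>r c j :: nat. c + (j - 1) * (r + 1)"
    and "m \<equiv> \<lambda>n r c :: nat. (n + (r + 1) - c) div (r + 1)"
  shows "contains_dist_incr n r k p
           \<longleftrightarrow> (\<exists>c\<in>{1..r + 1}. contains_consec_incr (m n r c) k (p \<circ> e r c))"
proof -
  have pos: "j \<le> m n r c \<longleftrightarrow> e r c j \<le> n" if "c \<in> {1..r + 1}" "j \<ge> 1" for c j
    using that by (cases j) (auto simp: m_def e_def less_eq_div_iff_mult_less_eq)
  have shift: "e r c (a + b) = e r c a + b * (r + 1)" if "a \<ge> 1" for a b c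
    using that by (cases a) (simp_all add: e_def algebra_simps)
  have "contains_consec_incr (m n r c) k (p \<circ> e r c) \<longleftrightarrow>
      (\<exists>a\<ge>1. e r c a + (k - 1) * (r + 1) \<le> n \<and>
        (\<forall>j<k - 1. p (e r c a + j * (r + 1)) < p (e r c a + (j + 1) * (r + 1))))"
    if c: "c \<in> {1..r + 1}" for c
    unfolding contains_consec_incr_def
  proof (intro ex_cong1 conj_cong refl all_cong)
    fix a j :: nat
    assume a: "a \<ge> 1"
    show "a + (k - 1) \<le> m n r c \<longleftrightarrow> e r c a + (k - 1) * (r + 1) \<le> n"
      using pos[OF c, of "a + (k - 1)"] shift[OF a] a by simp
    show "(p \<circ> e r c) (a + j) < (p \<circ> e r c) (a + j + 1) \<longleftrightarrow>
        p (e r c a + j * (r + 1)) < p (e r c a + (j + 1) * (r + 1))"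
      using shift[OF a, of c j] shift[OF a, of c "j + 1"] by (simp add: add.assoc)
  qed
  \<comment> \<open>Both indices start at 1, so the class and the index of \<open>y\<close> are read
    off from dividing \<open>y - 1\<close> by \<open>r + 1\<close>.\<close>
  moreover have "\<exists>c\<in>{1..r + 1}. \<exists>a\<ge>1. y = e r c a" if "y \<ge> 1" for y
  proof (intro bexI exI conjI)
    show "y = e r ((y - 1) mod (r + 1) + 1) ((y - 1) div (r + 1) + 1)"
      using that mod_mult_div_eq[of "y - 1" "r + 1"] by (simp add: e_def mult.commute)
  qed (auto simp: Suc_le_eq)
  moreover have "e r c a \<ge> 1" if "c \<in> {1..r + 1}" for c a
    using that by (simp add: e_def)
  ultimately show ?thesis unfolding contains_dist_incr_def by (smt (verit, best))
qed

text \<open>Removing the full periods from \<open>n\<close> leaves \<open>u + (r + 1) - c\<close> to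
  be divided by \<open>r + 1\<close>. This is below \<open>2 * (r + 1)\<close>, and it reaches
  \<open>r + 1\<close> exactly when \<open>c \<le> u\<close>.\<close>

lemma residue_class_size:
  fixes n r c :: nat
  assumes "c \<in> {1..r + 1}"
  shows "(n + (r + 1) - c) div (r + 1)
           = n div (r + 1) + (if c \<le> n mod (r + 1) then 1 else 0)"
proof -
  define u where "u = n mod (r + 1)"
  have "n + (r + 1) - c = (u + (r + 1) - c) + n div (r + 1) * (r + 1)"
    using assms mod_div_mult_eq[of n "r + 1"] unfolding u_def by auto
  then have "(n + (r + 1) - c) div (r + 1) = n div (r + 1) + (u + (r + 1) - c) div (r + 1)"
    by (metis add_cancel_right_right add.commute div_mult_self1 Suc_eq_plus1 nat.distinct(1))
  moreover have "(u + (r + 1) - c) div (r + 1) = (if c \<le> u then 1 else 0)"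
  proof -
    have "u < r + 1" by (simp add: u_def)
    then show ?thesis using assms by (cases "c \<le> u") (auto intro!: div_nat_eqI)
  qed
  ultimately show ?thesis by (simp add: u_def)
qed

text \<open>Generic in \<open>f\<close> because it evaluates both the product of factorials and the
  product of avoider counts.\<close>

lemma prod_residue_class_size:
  fixes f :: "nat \<Rightarrow> 'a :: comm_monoid_mult"
  shows "(\<Prod>c\<in>{1..r + 1}. f ((n + (r + 1) - c) div (r + 1)))
    = f (n div (r + 1)) ^ (r + 1 - n mod (r + 1)) * f (n div (r + 1) + 1) ^ (n mod (r + 1))"
proof -
  define u where "u = n mod (r + 1)"
  have u: "u < r + 1" by (simp add: u_def)
  have "(\<Prod>c\<in>{1..r + 1}. f ((n + (r + 1) - c) div (r + 1)))
      = (\<Prod>c\<in>{1..r + 1}. if c \<le> u then f (n div (r + 1) + 1) else f (n div (r + 1)))"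
    by (rule prod.cong) (simp_all only: residue_class_size u_def split: if_split, simp)
  also have "\<dots> = f (n div (r + 1) + 1) ^ card ({1..r + 1} \<inter> {c. c \<le> u})
      * f (n div (r + 1)) ^ card ({1..r + 1} \<inter> - {c. c \<le> u})"
    by (simp only: prod.If_cases finite_atLeastAtMost prod_constant)
  also have "{1..r + 1} \<inter> {c. c \<le> u} = {1..u}" using u by auto
  also have "{1..r + 1} \<inter> - {c. c \<le> u} = {u<..r + 1}" by auto
  finally show ?thesis by (simp add: u_def mult.commute)
qed

lemma card_Av_dist_incr_mult:
  shows "card (Av_dist_incr n r k)
      * (\<Prod>c\<in>{1..r + 1}. fact ((n + (r + 1) - c) div (r + 1)))
    = fact n * (\<Prod>c\<in>{1..r + 1}. card (Av_consec_incr ((n + (r + 1) - c) div (r + 1)) k))"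
proof -
  define e where "e = (\<lambda>c j :: nat. c + (j - 1) * (r + 1))"
  define m where "m c = (n + (r + 1) - c) div (r + 1)" for c
  define C where "C c = e c ` {1..m c}" for c
  define P where "P c p \<longleftrightarrow> \<not> contains_consec_incr (m c) k (p \<circ> e c)" for c p
  have Av: "Av_dist_incr n r k = {p. p permutes {1..n} \<and> (\<forall>c\<in>{1..r + 1}. P c p)}"
    unfolding Av_dist_incr_def contains_dist_incr_iff_residue_class P_def e_def m_def
    by blast
  have inj: "inj_on (e c) {1..m c}" for c
  proof (rule inj_onI)
    fix x y assume "x \<in> {1..m c}" "y \<in> {1..m c}" "e c x = e c y"
    then show "x = y" by (cases x; cases y) (simp_all add: e_def del: mult_Suc_right)
  qed
  then have card_C: "card (C c) = m c" for c by (simp add: C_def card_image)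
  have "card (Av_dist_incr n r k) * (\<Prod>c\<in>{1..r + 1}. fact (card (C c)))
      = fact (card {1..n}) * (\<Prod>c\<in>{1..r + 1}. card (Av_consec_incr (m c) k))"
    unfolding Av
  proof (rule card_permutes_blockwise)
    fix c assume c: "c \<in> {1..r + 1}"
    show "C c \<subseteq> {1..n}"
    proof
      fix x assume "x \<in> C c"
      then obtain j where j: "j \<ge> 1" "j \<le> m c" "x = e c j" by (auto simp: C_def)
      then show "x \<in> {1..n}" using c
        by (cases j) (auto simp: m_def e_def less_eq_div_iff_mult_less_eq)
    qed
    show "P c p \<longleftrightarrow> P c q" if "\<And>x. x \<in> C c \<Longrightarrow> p x = q x" for p q
      unfolding P_def
      by (subst contains_consec_incr_cong[of _ "p \<circ> e c" "q \<circ> e c"]) (auto simp: that C_def)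
    show "card {s. s permutes C c \<and> P c (p \<circ> s)} = card (Av_consec_incr (m c) k)"
      if "p permutes {1..n}" for p
      using card_avoiding_rearrangements_image[OF inj permutes_inj[OF that]]
      by (simp add: P_def C_def)
  next
    fix c c' assume c: "c \<in> {1..r + 1}" "c' \<in> {1..r + 1}" "c \<noteq> c'"
    \<comment> \<open>An element of a class determines the class, which makes distinct classes
      disjoint. The shift by 1 moves the representatives \<open>1..r + 1\<close> to the remainders
      \<open>0..r\<close>.\<close>
    have "c - 1 = (x - 1) mod (r + 1)" if "x \<in> C c" "c \<in> {1..r + 1}" for x c
    proof -
      obtain j where "x = c + j * (r + 1)" using \<open>x \<in> C c\<close> unfolding C_def e_def by blast
      then have "x - 1 = (c - 1) + j * (r + 1)" using that(2) by simp
      then show ?thesis using that(2) by (simp only: mod_mult_self1) auto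
    qed
    from this[of _ c] this[of _ c'] have "c - 1 = c' - 1" if "x \<in> C c" "x \<in> C c'" for x
      using that c(1,2) by metis
    then show "C c \<inter> C c' = {}" using c by fastforce
  qed auto
  then show ?thesis by (simp only: card_C card_atLeastAtMost) (simp add: m_def)
qed

text \<open>Inversion turns a difference of values into an equal distance of positions, and a gap of
  r letters is a distance of r + 1. Hence the progression has difference \<open>r + 1\<close>, not r
  as in the informal statement. With difference r the first equality can fail: for n = k = 2 and r =
  1 only 21 avoids the progression 1, 2, while both permutations avoid the distant pattern.\<close>

theorem theorem5p10:
  fixes n k r l u :: nat
  assumes "n \<ge> 1" and "k > 1" and "r > 0"
    and "l = n div (r + 1)" and "u = n mod (r + 1)"
  shows "card (Av_arith_prog n k (r + 1)) = card (Av_dist_incr n r k) \<and>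
    real (card (Av_dist_incr n r k)) =
      fact n / (fact l ^ (r + 1 - u) * fact (l + 1) ^ u)
        * real (card (Av_consec_incr l k)) ^ (r + 1 - u)
        * real (card (Av_consec_incr (l + 1) k)) ^ u"
proof
  show "card (Av_arith_prog n k (r + 1)) = card (Av_dist_incr n r k)"
    using assms(2) by (rule card_Av_arith_prog)
  have "card (Av_dist_incr n r k) * (fact l ^ (r + 1 - u) * fact (l + 1) ^ u)
      = fact n * (card (Av_consec_incr l k) ^ (r + 1 - u) * card (Av_consec_incr (l + 1) k) ^ u)"
    using card_Av_dist_incr_mult[of n r k]
    unfolding prod_residue_class_size[where f = fact]
      prod_residue_class_size[where f = "\<lambda>i. card (Av_consec_incr i k)"] assms(4,5) .
  \<comment> \<open>The identity moves to the reals, where the nonzero factorials can be divided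
    out.\<close>
  then have "real (card (Av_dist_incr n r k)) * (fact l ^ (r + 1 - u) * fact (l + 1) ^ u)
      = fact n * (real (card (Av_consec_incr l k)) ^ (r + 1 - u)
          * real (card (Av_consec_incr (l + 1) k)) ^ u)"
    by (metis (no_types, lifting) of_nat_fact of_nat_mult of_nat_power)
  then show "real (card (Av_dist_incr n r k)) =
      fact n / (fact l ^ (r + 1 - u) * fact (l + 1) ^ u)
        * real (card (Av_consec_incr l k)) ^ (r + 1 - u)
        * real (card (Av_consec_incr (l + 1) k)) ^ u"
    by (simp add: divide_simps del: fact_Suc)
qed

end
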